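(* Let $(d_1,d_2,d_3)$ be an $\varepsilon$-hyper relative differential operator on a Lie algebra $\mathfrak g$ with respect to a representation $(V;\rho)$, and let $T_i=d_i^{-1}$. Then $(T_i,d_k)$ is a KD-structure on $\mathfrak g$ with respect to $(V;\rho)$ for all $i,k\in\mathbb Z_3$ with $i\neq k$.
   Context: Everything is over a ground field $\mathbb K$. Let $\mathfrak g$ be a Lie algebra and $\rho:\mathfrak g\to\mathfrak{gl}(V)$ a representation, denoted $(V;\rho)$. A relative differential operator (with respect to $(V;\rho)$) is a linear map $d:\mathfrak g\to V$ with $d[x,y]=\rho(x)d(y)-\rho(y)d(x)$ for all $x,y\in\mathfrak g$. An $\mathcal O$-operator (with respect to $(V;\rho)$) is a linear map $T:V\to\mathfrak g$ with $[Tu,Tv]=T(\rho(Tu)v-\rho(Tv)u)$ for all $u,v\in V$. Indices are in $\mathbb Z_3=\{1,2,3\}$ (mod 3). Let $d_1,d_2,d_3:\mathfrak g\to V$ be invertible relative differential operators with respect to $(V;\rho)$; set $T_i:=d_i^{-1}$ and $N_i:=T_{i-1}\circ d_{i+1}$. If $N_i^2=\varepsilon_i\,\mathrm{Id}_{\mathfrak g}$ with $\varepsilon_i\in\{1,-1\}$ for $i=1,2,3$, the triple $(d_1,d_2,d_3)$ is called an $\varepsilon=(\varepsilon_1,\varepsilon_2,\varepsilon_3)$-hyper relative differential operator. A KD-structure on $\mathfrak g$ with respect to $(V;\rho)$ is a pair $(T,d)$, where $T:V\to\mathfrak g$ is an $\mathcal O$-operator and $d:\mathfrak g\to V$ a relative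 differential operator (both with respect to $(V;\rho)$), such that, with $N:=T\circ d$, the map $d\circ N$ is also a relative differential operator with respect to $(V;\rho)$. *)

theory Defs
  imports HOL.Vector_Spaces "HOL-Library.Numeral_Type"
begin

text \<open>The underlying space of a Lie algebra or of a representation is a whole type,
  with scalar multiplication given by the library locale \<^locale>\<open>vector_space\<close>. The ground
  field is arbitrary, of any characteristic, so the bracket is required to be alternating
  and not merely antisymmetric.\<close>

locale lie_algebra = vector_space scale
  for scale :: "'k::field \<Rightarrow> 'g::ab_group_add \<Rightarrow> 'g" +
  fixes bracket :: "'g \<Rightarrow> 'g \<Rightarrow> 'g"
  assumes bracket_linear_left: "\<And>y. Vector_Spaces.linear scale scale (\<lambda>x. bracket x y)"
    and bracket_linear_right: "\<And>x. Vector_Spaces.linear scale scale (\<lambda>y. bracket x y)"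
    and bracket_alternating: "\<And>x. bracket x x = 0"
    and jacobi: "\<And>x y z. bracket x (bracket y z) + bracket y (bracket z x)
                   + bracket z (bracket x y) = 0"

text \<open>In \<open>lie_representation\<close>, \<open>rho_linear\<close> states the linearity of
  \<open>rho\<close> as a map into \<open>gl(V)\<close>, evaluated at each vector \<open>v\<close>.\<close>

locale lie_representation =
  lie_algebra scaleG bracket + V: vector_space scaleV
  for scaleG :: "'k::field \<Rightarrow> 'g::ab_group_add \<Rightarrow> 'g"
    and bracket :: "'g \<Rightarrow> 'g \<Rightarrow> 'g"
    and scaleV :: "'k \<Rightarrow> 'v::ab_group_add \<Rightarrow> 'v" +
  fixes rho :: "'g \<Rightarrow> 'v \<Rightarrow> 'v"
  assumes rho_endo: "\<And>x. Vector_Spaces.linear scaleV scaleV (rho x)"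
    and rho_linear: "\<And>v. Vector_Spaces.linear scaleG scaleV (\<lambda>x. rho x v)"
    and rho_bracket: "\<And>x y v. rho (bracket x y) v = rho x (rho y v) - rho y (rho x v)"

definition relative_differential_operator ::
  "('k::field \<Rightarrow> 'g::ab_group_add \<Rightarrow> 'g) \<Rightarrow> ('g \<Rightarrow> 'g \<Rightarrow> 'g) \<Rightarrow>
   ('k \<Rightarrow> 'v::ab_group_add \<Rightarrow> 'v) \<Rightarrow> ('g \<Rightarrow> 'v \<Rightarrow> 'v) \<Rightarrow> ('g \<Rightarrow> 'v) \<Rightarrow> bool" where
  "relative_differential_operator scaleG bracket scaleV rho d \<longleftrightarrow>
     Vector_Spaces.linear scaleG scaleV d \<and>
     (\<forall>x y. d (bracket x y) = rho x (d y) - rho y (d x))"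

definition O_operator ::
  "('k::field \<Rightarrow> 'g::ab_group_add \<Rightarrow> 'g) \<Rightarrow> ('g \<Rightarrow> 'g \<Rightarrow> 'g) \<Rightarrow>
   ('k \<Rightarrow> 'v::ab_group_add \<Rightarrow> 'v) \<Rightarrow> ('g \<Rightarrow> 'v \<Rightarrow> 'v) \<Rightarrow> ('v \<Rightarrow> 'g) \<Rightarrow> bool" where
  "O_operator scaleG bracket scaleV rho T \<longleftrightarrow>
     Vector_Spaces.linear scaleV scaleG T \<and>
     (\<forall>u v. bracket (T u) (T v) = T (rho (T u) v - rho (T v) u))"

definition KD_structure ::
  "('k::field \<Rightarrow> 'g::ab_group_add \<Rightarrow> 'g) \<Rightarrow> ('g \<Rightarrow> 'g \<Rightarrow> 'g) \<Rightarrow>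
   ('k \<Rightarrow> 'v::ab_group_add \<Rightarrow> 'v) \<Rightarrow> ('g \<Rightarrow> 'v \<Rightarrow> 'v) \<Rightarrow> ('v \<Rightarrow> 'g) \<Rightarrow> ('g \<Rightarrow> 'v) \<Rightarrow> bool" where
  "KD_structure scaleG bracket scaleV rho T d \<longleftrightarrow>
     O_operator scaleG bracket scaleV rho T \<and>
     relative_differential_operator scaleG bracket scaleV rho d \<and>
     (let N = T \<circ> d in relative_differential_operator scaleG bracket scaleV rho (d \<circ> N))"

text \<open>Triples are families indexed by the three-element type \<open>3\<close> of integers modulo 3;
  its elements are \<open>1\<close>, \<open>2\<close> and \<open>3 = 0\<close>, and \<open>i - 1\<close>, \<open>i + 1\<close> are computed modulo 3.\<close>

definition hyper_relative_differential_operator ::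
  "('k::field \<Rightarrow> 'g::ab_group_add \<Rightarrow> 'g) \<Rightarrow> ('g \<Rightarrow> 'g \<Rightarrow> 'g) \<Rightarrow>
   ('k \<Rightarrow> 'v::ab_group_add \<Rightarrow> 'v) \<Rightarrow> ('g \<Rightarrow> 'v \<Rightarrow> 'v) \<Rightarrow> (3 \<Rightarrow> 'k) \<Rightarrow> (3 \<Rightarrow> 'g \<Rightarrow> 'v) \<Rightarrow> bool" where
  "hyper_relative_differential_operator scaleG bracket scaleV rho \<epsilon> d \<longleftrightarrow>
     (\<forall>i. relative_differential_operator scaleG bracket scaleV rho (d i) \<and> bij (d i)) \<and>
     (\<forall>i. \<epsilon> i \<in> {1, -1}) \<and>
     (\<forall>i. let N = inv (d (i - 1)) \<circ> d (i + 1) in \<forall>x. (N \<circ> N) x = scaleG (\<epsilon> i) x)"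

end

theory Submission
  imports Defs
begin

text \<open>The inverse of a bijective relative differential operator is an \<open>O\<close>-operator: the two
  identities are the same identity read through the bijection. So the only question is whether
  \<open>d\<^sub>k \<circ> T\<^sub>i \<circ> d\<^sub>k\<close> is again a relative differential operator. Multiplying
  \<open>(T\<^sub>i \<circ> d\<^sub>k)\<^sup>2 = \<epsilon>\<close> by \<open>d\<^sub>i\<close> from the left gives
  \<open>d\<^sub>k \<circ> T\<^sub>i \<circ> d\<^sub>k = \<epsilon> d\<^sub>i\<close>, and scalar multiples of a relative differential
  operator are again such operators.

  The hypothesis on the squares concerns only the pairs with \<open>k = i - 1\<close> (equivalently
  \<open>k = i + 2\<close>), which is half of the pairs \<open>i \<noteq> k\<close>. For the other half, \<open>T\<^sub>k \<circ> d\<^sub>i\<close> is the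
  inverse of \<open>T\<^sub>i \<circ> d\<^sub>k\<close>, and an invertible map whose square is a scalar \<open>\<epsilon>\<close> with \<open>\<epsilon>\<^sup>2 = 1\<close>
  has an inverse with the same square.\<close>

context lie_representation
begin

lemma inv_relative_differential_operator_O_operator:
  assumes d: "relative_differential_operator scaleG bracket scaleV rho d" and "bij d"
  shows "O_operator scaleG bracket scaleV rho (inv d)"
proof -
  have lin: "Vector_Spaces.linear scaleG scaleV d"
    and der: "\<And>x y. d (bracket x y) = rho x (d y) - rho y (d x)"
    using d by (auto simp: relative_differential_operator_def)
  interpret d: Vector_Spaces.linear scaleG scaleV d by (rule lin)
  have left [simp]: "inv d (d x) = x" for x
    using \<open>bij d\<close> by (simp add: bij_is_inj)
  have right [simp]: "d (inv d v) = v" for v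
    using \<open>bij d\<close> by (simp add: bij_is_surj surj_f_inv_f)
  have inv_eq: "inv d v = x" if "d x = v" for x v
    using that left by blast
  have "Vector_Spaces.linear scaleV scaleG (inv d)"
    by unfold_locales (auto intro!: inv_eq simp: d.add d.scale)
  moreover have "bracket (inv d u) (inv d v) = inv d (rho (inv d u) v - rho (inv d v) u)" for u v
    by (rule inv_eq [symmetric]) (simp add: der)
  ultimately show ?thesis
    by (simp add: O_operator_def)
qed

lemma relative_differential_operator_scale:
  assumes d: "relative_differential_operator scaleG bracket scaleV rho d"
  shows "relative_differential_operator scaleG bracket scaleV rho (\<lambda>x. scaleV c (d x))"
proof -
  have lin: "Vector_Spaces.linear scaleG scaleV d"
    and der: "\<And>x y. d (bracket x y) = rho x (d y) - rho y (d x)"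
    using d by (auto simp: relative_differential_operator_def)
  interpret d: Vector_Spaces.linear scaleG scaleV d by (rule lin)
  have rho_scale: "rho x (scaleV c v) = scaleV c (rho x v)" for x v
  proof -
    interpret r: Vector_Spaces.linear scaleV scaleV "rho x" by (rule rho_endo)
    show ?thesis by (rule r.scale)
  qed
  have "Vector_Spaces.linear scaleG scaleV (\<lambda>x. scaleV c (d x))"
    by unfold_locales
      (simp_all add: d.add d.scale V.scale_right_distrib mult.commute)
  then show ?thesis
    by (simp add: relative_differential_operator_def der rho_scale V.scale_right_diff_distrib)
qed

lemma KD_structure_inv:
  assumes "relative_differential_operator scaleG bracket scaleV rho d" "bij d"
    and "relative_differential_operator scaleG bracket scaleV rho e"
    and sandwich: "\<And>x. e (inv d (e x)) = scaleV c (d x)"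
  shows "KD_structure scaleG bracket scaleV rho (inv d) e"
proof -
  have "e \<circ> (inv d \<circ> e) = (\<lambda>x. scaleV c (d x))"
    by (simp add: fun_eq_iff sandwich)
  then show ?thesis
    using assms inv_relative_differential_operator_O_operator relative_differential_operator_scale
    by (simp add: KD_structure_def)
qed

text \<open>One condition on the square serves both orders of the pair. From
  \<open>e \<circ> d\<^sup>-\<^sup>1 \<circ> e = c d\<close> and \<open>c\<^sup>2 = 1\<close> one gets \<open>d = c (e \<circ> d\<^sup>-\<^sup>1 \<circ> e)\<close>; substituting this for
  the outer \<open>d\<close> in \<open>d \<circ> e\<^sup>-\<^sup>1 \<circ> d\<close>, everything cancels except \<open>c e\<close>.\<close>

lemma KD_structure_of_square_scalar:
  assumes d: "relative_differential_operator scaleG bracket scaleV rho d" "bij d"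
    and e: "relative_differential_operator scaleG bracket scaleV rho e" "bij e"
    and square: "\<And>x. inv d (e (inv d (e x))) = scaleG c x"
    and c: "c * c = 1"
  shows "KD_structure scaleG bracket scaleV rho (inv d) e"
    and "KD_structure scaleG bracket scaleV rho (inv e) d"
proof -
  interpret d: Vector_Spaces.linear scaleG scaleV d
    using d by (simp add: relative_differential_operator_def)
  have d_inv [simp]: "d (inv d v) = v" and e_inv [simp]: "e (inv e v) = v" for v
    using \<open>bij d\<close> \<open>bij e\<close> by (simp_all add: bij_is_surj surj_f_inv_f)
  have d_left [simp]: "inv d (d x) = x" for x
    using \<open>bij d\<close> by (simp add: bij_is_inj)
  have ede: "e (inv d (e x)) = scaleV c (d x)" for x
    by (metis square d_inv d.scale)
  have ded: "d (inv e (d x)) = scaleV c (e x)" for x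
  proof -
    have "d (inv e (d x)) = scaleV c (scaleV c (d (inv e (d x))))"
      by (simp add: c)
    also have "\<dots> = scaleV c (e (inv d (e (inv e (d x)))))"
      by (simp only: ede)
    finally show ?thesis by simp
  qed
  show "KD_structure scaleG bracket scaleV rho (inv d) e"
    using d e(1) ede by (rule KD_structure_inv)
  show "KD_structure scaleG bracket scaleV rho (inv e) d"
    using e d(1) ded by (rule KD_structure_inv)
qed

end

lemma distinct_mod3_consecutive:
  fixes i k :: 3
  assumes "i \<noteq> k"
  obtains "k = i - 1" | "i = k - 1"
proof -
  have residue: "j = 0 \<or> j = 1 \<or> j = 2" for j :: 3
  proof (cases j rule: bit1_cases)
    case (of_int z)
    then have "z = 0 \<or> z = 1 \<or> z = 2" by auto
    with of_int show ?thesis by auto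
  qed
  have "(-1 :: 3) = 2" "(-2 :: 3) = 1"
    by simp_all
  then have "i = k \<or> k = i - 1 \<or> i = k - 1"
    using residue [of i] residue [of k] by auto
  with assms that show ?thesis by blast
qed

theorem proposition3p2:
  fixes scaleG :: "'k::field \<Rightarrow> 'g::ab_group_add \<Rightarrow> 'g"
    and bracket :: "'g \<Rightarrow> 'g \<Rightarrow> 'g"
    and scaleV :: "'k \<Rightarrow> 'v::ab_group_add \<Rightarrow> 'v"
    and rho :: "'g \<Rightarrow> 'v \<Rightarrow> 'v"
    and \<epsilon> :: "3 \<Rightarrow> 'k"
    and d :: "3 \<Rightarrow> 'g \<Rightarrow> 'v"
  assumes "lie_representation scaleG bracket scaleV rho"
    and "hyper_relative_differential_operator scaleG bracket scaleV rho \<epsilon> d"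
  shows "\<forall>i k. i \<noteq> k \<longrightarrow> KD_structure scaleG bracket scaleV rho (inv (d i)) (d k)"
proof (intro allI impI)
  fix i k :: 3
  assume "i \<noteq> k"
  interpret lie_representation scaleG bracket scaleV rho by (rule assms(1))
  have d: "relative_differential_operator scaleG bracket scaleV rho (d j)" "bij (d j)" for j
    using assms(2) by (auto simp: hyper_relative_differential_operator_def)
  have unit: "\<epsilon> j * \<epsilon> j = 1" for j
  proof -
    have "\<epsilon> j \<in> {1, -1}"
      using assms(2) unfolding hyper_relative_differential_operator_def by blast
    then show ?thesis by auto
  qed
  have square: "inv (d j) (d (j - 1) (inv (d j) (d (j - 1) x))) = scaleG (\<epsilon> (j + 1)) x" for j x
  proof -
    \<comment> \<open>The square condition at the index \<open>j + 1\<close>, whose successor is \<open>j + 2 = j - 1\<close>.\<close>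
    have "(j + 1) + 1 = j - 1" "(j + 1) - 1 = j"
      by (simp_all add: algebra_simps)
    moreover have "\<forall>i x. inv (d (i - 1)) (d (i + 1) (inv (d (i - 1)) (d (i + 1) x))) = scaleG (\<epsilon> i) x"
      using assms(2) by (simp add: hyper_relative_differential_operator_def Let_def)
    ultimately show ?thesis by metis
  qed
  from \<open>i \<noteq> k\<close> show "KD_structure scaleG bracket scaleV rho (inv (d i)) (d k)"
  proof (cases rule: distinct_mod3_consecutive)
    case 1
    show ?thesis
      unfolding 1 by (rule KD_structure_of_square_scalar(1) [OF d d square unit])
  next
    case 2
    show ?thesis
      unfolding 2 by (rule KD_structure_of_square_scalar(2) [OF d d square unit])
  qed
qed

end
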